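(* Let $\mathbf{k}$ be an algebraically closed field of characteristic $0$. Let $\phi=(ax+ P(y), by+c)\in \mathbb{J}_n$ be such that $\deg P(y)=n$. Suppose $b=1$ and $c\neq 0$. Then the following are true: (i) Suppose $a=1$. Then $\mathrm{Supp}\,\mathfrak{I}_{\phi}=\mathbb{A}^2$, and $\mathfrak{I}_{\phi}$ is generated by the fibers of a quotient map $\hat{x}:\mathbb{A}^2 \rightarrow \mathbb{A}^1$, $(x,y) \mapsto x-g(y)$, for some $g\in\mathbf{k}[y]$ with $\deg g=n+1$. In particular, $\mathfrak{I}_{\phi}$ contains no $0$-dimensional element, i.e. $\phi$ has no torsion point. (ii) Suppose $a \neq 1$ is a root of unity. Then $\mathrm{Supp}\,\mathfrak{I}_{\phi}=\mathbb{A}^2$, and $\mathfrak{I}_{\phi}$ is generated by some unions of fibers of a $\phi$-equivariant map $\overline{x}:\mathbb{A}^2\rightarrow \mathbb{A}^1$. Such $\phi$ has no torsion point. (iii) Suppose $a$ is not a root of unity. Then $\mathfrak{I}_{\phi}$ consists of exactly three elements: the empty set $\emptyset$, a curve isomorphic to $\mathbb{A}^1$, and the whole $\mathbb{A}^2$.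
   Context: $\mathbb{J}_n=\{(ax+P(y),by+c): a,b\in\mathbf{k}^\times,\ c\in\mathbf{k},\ P\in\mathbf{k}[y],\ \deg P\le n\}\subset\mathrm{Aut}(\mathbb{A}^2)$, acting on $\mathbb{A}^2=\mathrm{Spec}\,\mathbf{k}[x,y]$. A variety is a reduced separated scheme of finite type over $\mathbf{k}$, not necessarily irreducible, connected or pure dimensional; a curve is a 1-dimensional variety. Invariant subvariety lattice: for a group $G$ acting algebraically on a variety $X$, $\mathfrak{I}_G$ is the set of all $G$-invariant closed subvarieties $Y\subset X$ (including $\emptyset$ and $X$); $\mathfrak{I}_\phi:=\mathfrak{I}_{\langle\phi\rangle}$ with $X=\mathbb{A}^2$. The support $\mathrm{Supp}\,\mathfrak{I}$ of a lattice $\mathfrak{I}$ of subvarieties of $X$ is the union of all $Y\in\mathfrak{I}$ with $Y\neq X$. A subset $\mathcal{I}\subset\mathfrak{I}_\phi$ generates $\mathfrak{I}_\phi$ if every element of $\mathfrak{I}_\phi$ except $\mathbb{A}^2$ is a union of elements of $\mathcal{I}$. "Generated by some unions of fibers of $\pi$" means that there is a generating subset of $\mathfrak{I}_\phi$ each of whose elements is a union of fibers of $\pi$. A torsion point of $\phi$ is a point with finite $\langle\phi\rangle$-orbit. A morphism $\pi:\mathbb{A}^2\to\mathbb{A}^1$ is $\phi$-equivariant if there is $\overline\phi\in\mathrm{Aut}(\mathbb{A}^1)$ with $\pi\circ\phi=\overline\phi\circ\pi$. *)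

theory Defs
  imports
    "HOL-Computational_Algebra.Polynomial"
    "HOL-Algebra.Bij"
    "HOL-Algebra.Generated_Groups"
begin

text \<open>
  The ground field is algebraically closed, so a closed (reduced) subvariety of the affine plane is
  identified with its set of closed points, a Zariski closed subset of \<open>'k \<times> 'k\<close>, and a morphism
  with the polynomial map it induces on closed points.
\<close>

text \<open>A polynomial in \<open>x\<close>, \<open>y\<close> is represented in \<open>'k poly poly\<close>: the outer variable
  is \<open>y\<close>, the coefficients are polynomials in \<open>x\<close>.\<close>

definition eval2 :: "'k::comm_ring_1 poly poly \<Rightarrow> 'k \<times> 'k \<Rightarrow> 'k" where
  "eval2 f z = poly (poly f [:snd z:]) (fst z)"

definition regular1 :: "('k::comm_ring_1 \<Rightarrow> 'k) set" where
  "regular1 = range poly"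

definition regular2 :: "('k::comm_ring_1 \<times> 'k \<Rightarrow> 'k) set" where
  "regular2 = range eval2"

definition zclosed :: "('k::comm_ring_1 \<times> 'k) set \<Rightarrow> bool" where
  "zclosed Y \<longleftrightarrow> (\<exists>F :: 'k poly poly set. Y = {z. \<forall>f\<in>F. eval2 f z = 0})"

definition zirreducible :: "('k::comm_ring_1 \<times> 'k) set \<Rightarrow> bool" where
  "zirreducible Y \<longleftrightarrow> zclosed Y \<and> Y \<noteq> {} \<and>
     (\<forall>A B. zclosed A \<and> zclosed B \<and> Y = A \<union> B \<longrightarrow> Y = A \<or> Y = B)"

definition irr_chain :: "('k::comm_ring_1 \<times> 'k) set \<Rightarrow> nat \<Rightarrow> (nat \<Rightarrow> ('k \<times> 'k) set) \<Rightarrow> bool" where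
  "irr_chain Y d Z \<longleftrightarrow>
     (\<forall>i\<le>d. zirreducible (Z i) \<and> Z i \<subseteq> Y) \<and> (\<forall>i<d. Z i \<subset> Z (Suc i))"

text \<open>Krull dimension, as a relation; the empty set has no dimension in \<open>nat\<close>.\<close>

definition has_dim :: "('k::comm_ring_1 \<times> 'k) set \<Rightarrow> nat \<Rightarrow> bool" where
  "has_dim Y d \<longleftrightarrow> (\<exists>Z. irr_chain Y d Z) \<and> (\<forall>e Z. irr_chain Y e Z \<longrightarrow> e \<le> d)"

definition is_curve :: "('k::comm_ring_1 \<times> 'k) set \<Rightarrow> bool" where
  "is_curve C \<longleftrightarrow> zclosed C \<and> has_dim C 1"

text \<open>The morphism from the line has components \<open>p\<close>, \<open>q\<close>; its inverse is a regular function
  on \<open>C\<close>, i.e. the restriction of some \<open>r\<close> that is regular on the plane.\<close>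

definition iso_to_line :: "('k::comm_ring_1 \<times> 'k) set \<Rightarrow> bool" where
  "iso_to_line C \<longleftrightarrow> (\<exists>p\<in>regular1. \<exists>q\<in>regular1. \<exists>r\<in>regular2.
     (\<forall>t. (p t, q t) \<in> C \<and> r (p t, q t) = t) \<and>
     (\<forall>z\<in>C. (p (r z), q (r z)) = z))"

definition aut_line :: "('k::comm_ring_1 \<Rightarrow> 'k) set" where
  "aut_line = {f \<in> regular1. bij f \<and> inv_into UNIV f \<in> regular1}"

definition jonq_map :: "'k::comm_ring_1 \<Rightarrow> 'k poly \<Rightarrow> 'k \<Rightarrow> 'k \<Rightarrow> 'k \<times> 'k \<Rightarrow> 'k \<times> 'k" where
  "jonq_map a P b c = (\<lambda>(x, y). (a * x + poly P y, b * y + c))"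

definition jonq :: "nat \<Rightarrow> ('k::comm_ring_1 \<times> 'k \<Rightarrow> 'k \<times> 'k) set" where
  "jonq n = {jonq_map a P b c | a P b c. a \<noteq> 0 \<and> b \<noteq> 0 \<and> degree P \<le> n}"

definition cyc :: "('k \<times> 'k \<Rightarrow> 'k \<times> 'k) \<Rightarrow> ('k \<times> 'k \<Rightarrow> 'k \<times> 'k) set" where
  "cyc \<phi> = generate (BijGroup UNIV) {\<phi>}"

definition inv_lattice :: "('k::comm_ring_1 \<times> 'k \<Rightarrow> 'k \<times> 'k) set \<Rightarrow> ('k \<times> 'k) set set" where
  "inv_lattice G = {Y. zclosed Y \<and> (\<forall>g\<in>G. g ` Y = Y)}"

definition lattice_of :: "('k::comm_ring_1 \<times> 'k \<Rightarrow> 'k \<times> 'k) \<Rightarrow> ('k \<times> 'k) set set" where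
  "lattice_of \<phi> = inv_lattice (cyc \<phi>)"

definition Supp :: "('k \<times> 'k) set set \<Rightarrow> ('k \<times> 'k) set" where
  "Supp L = \<Union> {Y \<in> L. Y \<noteq> UNIV}"

text \<open>The empty set is the union of the empty family, so it need not belong to \<open>I\<close>.\<close>

definition generates :: "('k \<times> 'k) set set \<Rightarrow> ('k \<times> 'k) set set \<Rightarrow> bool" where
  "generates I L \<longleftrightarrow> I \<subseteq> L \<and> (\<forall>Y\<in>L. Y \<noteq> UNIV \<longrightarrow> (\<exists>S\<subseteq>I. Y = \<Union> S))"

definition torsion_point :: "('k \<times> 'k \<Rightarrow> 'k \<times> 'k) \<Rightarrow> 'k \<times> 'k \<Rightarrow> bool" where
  "torsion_point \<phi> z \<longleftrightarrow> finite ((\<lambda>g. g z) ` cyc \<phi>)"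

definition fibers :: "('k \<times> 'k \<Rightarrow> 'k) \<Rightarrow> ('k \<times> 'k) set set" where
  "fibers \<pi> = range (\<lambda>t. \<pi> -` {t})"

definition equivariant :: "('k::comm_ring_1 \<times> 'k \<Rightarrow> 'k \<times> 'k) \<Rightarrow> ('k \<times> 'k \<Rightarrow> 'k) \<Rightarrow> bool" where
  "equivariant \<phi> \<pi> \<longleftrightarrow> \<pi> \<in> regular2 \<and> (\<exists>\<psi>\<in>aut_line. \<pi> \<circ> \<phi> = \<psi> \<circ> \<pi>)"

text \<open>\<open>\<pi>\<close> is the algebraic quotient of the plane by \<open>G\<close>: pull-back along \<open>\<pi>\<close> identifies
  the coordinate ring of the line with the ring of \<open>G\<close>-invariant regular functions.\<close>

definition quotient_map :: "('k::comm_ring_1 \<times> 'k \<Rightarrow> 'k \<times> 'k) set \<Rightarrow> ('k \<times> 'k \<Rightarrow> 'k) \<Rightarrow> bool" where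
  "quotient_map G \<pi> \<longleftrightarrow> \<pi> \<in> regular2 \<and>
     bij_betw (\<lambda>h. h \<circ> \<pi>) regular1 {f \<in> regular2. \<forall>g\<in>G. f \<circ> g = f}"

definition root_of_unity :: "'k::comm_ring_1 \<Rightarrow> bool" where
  "root_of_unity a \<longleftrightarrow> (\<exists>m>0. a ^ m = 1)"

end

theory Submission
  imports Defs
begin

text \<open>
  A polynomial change of the coordinate \<open>x\<close> linearises the map. If \<open>g (y + c) - a g (y) = P (y)\<close>, then
  \<open>u = x - g (y)\<close> satisfies \<open>u \<circ> \<phi> = a u\<close>, so in the coordinates \<open>(u, y)\<close> the map \<open>\<phi>\<close> becomes
  \<open>(u, y) \<mapsto> (a u, y + c)\<close>. Such a \<open>g\<close> exists because \<open>g \<mapsto> g (y + c) - a g (y)\<close> multiplies the leading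
  coefficient by \<open>1 - a\<close> if \<open>a \<noteq> 1\<close> (lemma \<open>ex_twisted_difference\<close>), and because for \<open>a = 1\<close> it lowers
  the degree of nonconstant polynomials by exactly one, in characteristic \<open>0\<close> and with \<open>c \<noteq> 0\<close> (lemma \<open>ex_difference\<close>, which gives
  \<open>deg g = deg P + 1\<close>).

  Every fiber of \<open>u\<close> is a copy of the line, so a closed set that meets it in infinitely many points
  contains it (lemma \<open>level_fiber_subset_closed\<close>). Let \<open>Y\<close> be an invariant closed set.

  If \<open>a^k = 1\<close> with \<open>k > 0\<close>, the \<open>k\<close>-th iterate of \<open>\<phi>\<close> preserves each fiber of \<open>u\<close> and translates along
  it by \<open>k c \<noteq> 0\<close>. Hence \<open>Y\<close> contains with each point infinitely many points of its fiber, and so the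
  whole fiber: \<open>Y\<close> is a union of fibers of \<open>u\<close>. The points \<open>z\<close> with \<open>u (z)^k = t\<close> form a proper invariant
  closed set for every \<open>t\<close>, and these sets cover the plane. For \<open>a = 1\<close> the fibers themselves are
  invariant, and an invariant polynomial is constant along them by the same argument, hence a
  polynomial in \<open>u\<close>.

  If \<open>a\<close> is not a root of unity, the orbit of any point with \<open>u \<noteq> 0\<close> is Zariski dense: a polynomial
  vanishing on it gives a relation \<open>\<Sum>\<^sub>i (a^i)^m p\<^sub>i (m) = 0\<close> for all \<open>m\<close>, with distinct bases \<open>a^i\<close>, and
  exponential polynomials are linearly independent (lemma \<open>exponential_polynomials_independent\<close>).
  So \<open>Y\<close> is the plane or lies in the fiber \<open>u = 0\<close>. That fiber is invariant, and again \<open>Y\<close> contains all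
  of it if it contains one of its points.

  There are no torsion points in any case, because \<open>y\<close> takes the distinct values \<open>y + m c\<close> on an orbit.
\<close>

section \<open>Regular functions\<close>

lemma eval2_0 [simp]: "eval2 0 z = 0"
  by (simp add: eval2_def)

lemma eval2_pCons [simp]: "eval2 (pCons p f) z = poly p (fst z) + snd z * eval2 f z"
  by (simp add: eval2_def)

lemma eval2_add: "eval2 (f + g) z = eval2 f z + eval2 g z"
  by (simp add: eval2_def)

lemma eval2_mult: "eval2 (f * g) z = eval2 f z * eval2 g z"
  by (simp add: eval2_def)

lemma regular1_const: "(\<lambda>t. d) \<in> regular1"
  unfolding regular1_def by (rule range_eqI[of _ _ "[:d:]"]) auto

lemma regular1_id: "(\<lambda>t. t) \<in> regular1"
  unfolding regular1_def by (rule range_eqI[of _ _ "[:0, 1:]"]) auto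

lemma regular1_poly: "poly p \<in> regular1"
  by (simp add: regular1_def)

lemma regular1_add: "p \<in> regular1 \<Longrightarrow> q \<in> regular1 \<Longrightarrow> (\<lambda>t. p t + q t) \<in> regular1"
  unfolding regular1_def by (auto simp flip: poly_add)

lemma regular1_mult: "p \<in> regular1 \<Longrightarrow> q \<in> regular1 \<Longrightarrow> (\<lambda>t. p t * q t) \<in> regular1"
  unfolding regular1_def by (auto simp flip: poly_mult)

lemma regular1_poly_comp: "p \<in> regular1 \<Longrightarrow> (\<lambda>t. poly q (p t)) \<in> regular1"
  by (induction q) (simp_all add: regular1_const regular1_add regular1_mult)

lemma regular2_const: "(\<lambda>z. d) \<in> regular2"
  unfolding regular2_def by (rule range_eqI[of _ _ "[:[:d:]:]"]) auto

lemma regular2_fst: "fst \<in> regular2"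
  unfolding regular2_def by (rule range_eqI[of _ _ "[:[:0, 1:]:]"]) auto

lemma regular2_snd: "snd \<in> regular2"
  unfolding regular2_def by (rule range_eqI[of _ _ "[:0, 1:]"]) auto

lemma regular2_add: "p \<in> regular2 \<Longrightarrow> q \<in> regular2 \<Longrightarrow> (\<lambda>z. p z + q z) \<in> regular2"
  unfolding regular2_def by (auto simp flip: eval2_add)

lemma regular2_mult: "p \<in> regular2 \<Longrightarrow> q \<in> regular2 \<Longrightarrow> (\<lambda>z. p z * q z) \<in> regular2"
  unfolding regular2_def by (auto simp flip: eval2_mult)

lemma regular2_poly_comp: "p \<in> regular2 \<Longrightarrow> (\<lambda>z. poly q (p z)) \<in> regular2"
  by (induction q) (simp_all add: regular2_const regular2_add regular2_mult)

lemma regular2_diff: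
  assumes "p \<in> regular2" "q \<in> regular2"
  shows "(\<lambda>z. p z - q z) \<in> regular2"
  using regular2_add[OF assms(1) regular2_mult[OF regular2_const[of "- 1"] assms(2)]] by simp

lemma regular2_power: "p \<in> regular2 \<Longrightarrow> (\<lambda>z. p z ^ m) \<in> regular2"
  by (induction m) (simp_all add: regular2_const regular2_mult)

lemma regular1_comp_pair:
  assumes "f \<in> regular2" "p \<in> regular1" "q \<in> regular1"
  shows "(\<lambda>t. f (p t, q t)) \<in> regular1"
proof -
  have "(\<lambda>t. eval2 h (p t, q t)) \<in> regular1" for h
    by (induction h)
      (simp_all add: regular1_const regular1_add regular1_mult regular1_poly_comp assms)
  then show ?thesis
    using assms(1) by (auto simp: regular2_def)
qed

lemma regular2_comp_pair:
  assumes "f \<in> regular2" "p \<in> regular2" "q \<in> regular2"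
  shows "(\<lambda>z. f (p z, q z)) \<in> regular2"
proof -
  have "(\<lambda>z. eval2 h (p z, q z)) \<in> regular2" for h
    by (induction h)
      (simp_all add: regular2_const regular2_add regular2_mult regular2_poly_comp assms)
  then show ?thesis
    using assms(1) by (auto simp: regular2_def)
qed

lemma regular1_zero_if_infinite_zeros:
  fixes f :: "'k::idom \<Rightarrow> 'k"
  assumes "f \<in> regular1" "infinite {t. f t = 0}"
  shows "f t = 0"
proof -
  obtain p where "f = poly p"
    using assms(1) by (auto simp: regular1_def)
  then show ?thesis
    using assms(2) poly_roots_finite[of p] by (cases "p = 0") auto
qed

section \<open>Closed sets\<close>

text \<open>
  Closed sets become easier to exhibit when they are cut out by functions instead of by polynomials,
  since regularity of a function is established by closure properties.
\<close>

lemma zclosed_iff_regular2: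
  "zclosed Y \<longleftrightarrow> (\<exists>S\<subseteq>regular2. Y = {z. \<forall>f\<in>S. f z = 0})"
proof
  assume "zclosed Y"
  then obtain F where "Y = {z. \<forall>f\<in>F. eval2 f z = 0}"
    by (auto simp: zclosed_def)
  then show "\<exists>S\<subseteq>regular2. Y = {z. \<forall>f\<in>S. f z = 0}"
    by (intro exI[of _ "eval2 ` F"]) (auto simp: regular2_def)
next
  assume "\<exists>S\<subseteq>regular2. Y = {z. \<forall>f\<in>S. f z = 0}"
  then obtain S where "S \<subseteq> regular2" "Y = {z. \<forall>f\<in>S. f z = 0}"
    by blast
  moreover from this obtain F where "S = eval2 ` F"
    unfolding regular2_def by (meson subset_imageE)
  ultimately show "zclosed Y"
    unfolding zclosed_def by (intro exI[of _ F]) auto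
qed

lemma zclosed_zeros: "f \<in> regular2 \<Longrightarrow> zclosed {z. f z = 0}"
  unfolding zclosed_iff_regular2 by (rule exI[of _ "{f}"]) auto

lemma zclosed_UNIV: "zclosed UNIV"
  unfolding zclosed_def by (rule exI[of _ "{}"]) auto

lemma zclosed_empty: "zclosed {}"
  using zclosed_zeros[OF regular2_const[of 1]] by simp

lemma zclosed_singleton: "zclosed {z}"
proof -
  let ?f = "\<lambda>w. fst w - fst z" and ?g = "\<lambda>w. snd w - snd z"
  have "{?f, ?g} \<subseteq> regular2"
    using regular2_diff[OF regular2_fst regular2_const] regular2_diff[OF regular2_snd regular2_const]
    by auto
  moreover have "{z} = {w. \<forall>f\<in>{?f, ?g}. f w = 0}"
    by (auto simp: prod_eq_iff)
  ultimately show ?thesis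
    unfolding zclosed_iff_regular2 by blast
qed

text \<open>
  The products of one equation of \<open>A\<close> and one equation of \<open>B\<close> cut out \<open>A \<union> B\<close>, as there are no zero divisors.
\<close>

lemma zclosed_Un:
  fixes A B :: "('k::idom \<times> 'k) set"
  assumes "zclosed A" "zclosed B"
  shows "zclosed (A \<union> B)"
proof -
  obtain S T where S: "S \<subseteq> regular2" "A = {z. \<forall>f\<in>S. f z = 0}"
    and T: "T \<subseteq> regular2" "B = {z. \<forall>f\<in>T. f z = 0}"
    using assms unfolding zclosed_iff_regular2 by blast
  let ?U = "(\<lambda>(f, h) z. f z * h z) ` (S \<times> T)"
  have "?U \<subseteq> regular2"
    using S(1) T(1) by (auto intro!: regular2_mult)
  moreover have "A \<union> B = {z. \<forall>f\<in>?U. f z = 0}"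
    unfolding S(2) T(2) by fastforce
  ultimately show ?thesis
    unfolding zclosed_iff_regular2 by blast
qed

lemma zclosed_finite: "finite A \<Longrightarrow> zclosed (A :: ('k::idom \<times> 'k) set)"
proof (induction rule: finite_induct)
  case (insert z A)
  then show ?case
    using zclosed_Un[OF zclosed_singleton[of z]] by simp
qed (simp add: zclosed_empty)

lemma zirreducible_singleton: "zirreducible {z}"
proof -
  have "{z} = A \<or> {z} = B" if "{z} = A \<union> B" for A B
    using that subset_singletonD[of A z] by blast
  then show ?thesis
    by (simp add: zirreducible_def zclosed_singleton)
qed

lemma zirreducible_finite_singleton:
  fixes A :: "('k::idom \<times> 'k) set"
  assumes "zirreducible A" "finite A" "z \<in> A"
  shows "A = {z}"
proof -
  have "A = {z} \<union> (A - {z})"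
    using assms(3) by blast
  moreover have "zclosed {z}" "zclosed (A - {z})"
    using assms(2) by (simp_all add: zclosed_finite)
  ultimately have "A = {z} \<or> A = A - {z}"
    using assms(1) unfolding zirreducible_def by blast
  then show ?thesis
    using assms(3) by blast
qed

section \<open>Fibers of a sheared first coordinate\<close>

abbreviation level :: "'k::comm_ring_1 poly \<Rightarrow> 'k \<times> 'k \<Rightarrow> 'k" where
  "level g \<equiv> \<lambda>(x, y). x - poly g y"

lemma regular2_level: "level g \<in> regular2"
  using regular2_diff[OF regular2_fst regular2_poly_comp[OF regular2_snd, of g]]
  by (simp add: case_prod_beta')

lemma level_fiber_eq: "level g -` {t} = range (\<lambda>y. (t + poly g y, y))"
  by (auto simp: image_iff)

lemma infinite_level_fiber: "infinite (level g -` {t :: 'k::{field_char_0}})"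
proof -
  have "inj (\<lambda>y. (t + poly g y, y))"
    by (auto intro: injI)
  then show ?thesis
    unfolding level_fiber_eq using infinite_UNIV_char_0 finite_imageD by blast
qed

lemma level_fiber_neq_UNIV: "level g -` {t :: 'k::comm_ring_1} \<noteq> UNIV"
proof -
  have "(t + poly g 0 + 1, 0) \<notin> level g -` {t}"
    by simp
  then show ?thesis
    by blast
qed

lemma zclosed_level_fiber: "zclosed (level g -` {t})"
  using zclosed_zeros[OF regular2_diff[OF regular2_level regular2_const, of g t]]
  by (simp add: vimage_def)

text \<open>
  An equation of \<open>Y\<close>, restricted to the parametrization \<open>y \<mapsto> (t + g (y), y)\<close> of the fiber, is a polynomial
  in \<open>y\<close> with infinitely many zeros.
\<close>

lemma level_fiber_subset_closed:
  fixes Y :: "('k::idom \<times> 'k) set"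
  assumes Y: "zclosed Y" and inf: "infinite (Y \<inter> level g -` {t})"
  shows "level g -` {t} \<subseteq> Y"
proof -
  define \<gamma> where "\<gamma> = (\<lambda>y. (t + poly g y, y))"
  obtain S where S: "S \<subseteq> regular2" "Y = {z. \<forall>f\<in>S. f z = 0}"
    using Y unfolding zclosed_iff_regular2 by blast
  have eq: "Y \<inter> level g -` {t} = \<gamma> ` {y. \<gamma> y \<in> Y}"
    by (auto simp: \<gamma>_def image_iff)
  have "infinite {y. \<gamma> y \<in> Y}"
    using inf unfolding eq by blast
  have "f (\<gamma> y) = 0" if f: "f \<in> S" for f y
  proof (rule regular1_zero_if_infinite_zeros[of "\<lambda>y. f (\<gamma> y)"])
    show "(\<lambda>y. f (\<gamma> y)) \<in> regular1"
      unfolding \<gamma>_def using f S(1)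
      by (intro regular1_comp_pair regular1_add regular1_const regular1_poly regular1_id) blast
    have "{y. \<gamma> y \<in> Y} \<subseteq> {y. f (\<gamma> y) = 0}"
      using f S(2) by blast
    then show "infinite {y. f (\<gamma> y) = 0}"
      using \<open>infinite {y. \<gamma> y \<in> Y}\<close> infinite_super by blast
  qed
  then show ?thesis
    unfolding level_fiber_eq S(2) \<gamma>_def[symmetric] by blast
qed

lemma zirreducible_level_fiber: "zirreducible (level g -` {t :: 'k::field_char_0})"
proof -
  have "level g -` {t} = A \<or> level g -` {t} = B"
    if "zclosed A" "zclosed B" and AB: "level g -` {t} = A \<union> B" for A B
  proof -
    have "infinite A \<or> infinite B"
      using infinite_level_fiber[of g t] unfolding AB by blast
    moreover have "A \<inter> level g -` {t} = A" "B \<inter> level g -` {t} = B"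
      using AB by blast+
    ultimately have "level g -` {t} \<subseteq> A \<or> level g -` {t} \<subseteq> B"
      using level_fiber_subset_closed[of A g t] level_fiber_subset_closed[of B g t] that
      by metis
    then show ?thesis
      using AB by blast
  qed
  moreover have "level g -` {t} \<noteq> {}"
    using infinite_level_fiber[of g t] by (metis finite.emptyI)
  ultimately show ?thesis
    unfolding zirreducible_def using zclosed_level_fiber[of g t] by blast
qed

lemma irr_chain_mono: "irr_chain X d Z \<Longrightarrow> X \<subseteq> Y \<Longrightarrow> irr_chain Y d Z"
  unfolding irr_chain_def by (meson order_trans)

lemma irr_chain_level_fiber:
  assumes "z \<in> level g -` {t :: 'k::field_char_0}"
  shows "irr_chain (level g -` {t}) 1 (\<lambda>i. if i = 0 then {z} else level g -` {t})"
proof -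
  have "{z} \<subset> level g -` {t}"
  proof
    show "{z} \<subseteq> level g -` {t}"
      using assms by blast
    show "{z} \<noteq> level g -` {t}"
      using infinite_level_fiber[of g t] by (metis finite.emptyI finite_insert)
  qed
  then show ?thesis
    by (auto simp: irr_chain_def zirreducible_singleton zirreducible_level_fiber)
qed

text \<open>
  A proper closed subset of a fiber is finite by \<open>level_fiber_subset_closed\<close>, hence a single point if it is
  irreducible. A chain of three irreducible closed subsets would thus need a proper nonempty subset of
  a point.
\<close>

lemma is_curve_level_fiber: "is_curve (level g -` {t :: 'k::field_char_0})"
proof -
  have "e \<le> 1" if Z: "irr_chain (level g -` {t}) e Z" for e Z
  proof (rule ccontr)
    assume "\<not> e \<le> 1"
    then have irr: "zirreducible (Z 0)" "zirreducible (Z 1)"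
      and sub: "Z 0 \<subset> Z 1" "Z 1 \<subset> Z 2" "Z 2 \<subseteq> level g -` {t}"
      using Z unfolding irr_chain_def
      by (auto simp: numeral_2_eq_2)
    have "finite (Z 1)"
    proof (rule ccontr)
      assume "infinite (Z 1)"
      moreover have "Z 1 \<inter> level g -` {t} = Z 1"
        using sub by blast
      ultimately have "level g -` {t} \<subseteq> Z 1"
        using level_fiber_subset_closed[of "Z 1" g t] irr(2) unfolding zirreducible_def by metis
      then show False
        using sub by blast
    qed
    moreover obtain z where "z \<in> Z 0"
      using irr(1) unfolding zirreducible_def by blast
    ultimately have "Z 1 = {z}"
      using zirreducible_finite_singleton[OF irr(2)] sub(1) by blast
    then show False
      using sub(1) \<open>z \<in> Z 0\<close> by auto
  qed
  moreover have "\<exists>Z. irr_chain (level g -` {t}) 1 Z"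
    using irr_chain_level_fiber[of "(t + poly g 0, 0)" g t] by auto
  ultimately show ?thesis
    using zclosed_level_fiber[of g t] unfolding is_curve_def has_dim_def by simp
qed

lemma iso_to_line_level_fiber: "iso_to_line (level g -` {t})"
proof -
  have "(\<lambda>y. t + poly g y) \<in> regular1"
    by (intro regular1_add regular1_const regular1_poly)
  moreover have "(t + poly g y, y) \<in> level g -` {t} \<and> snd (t + poly g y, y) = y" for y
    by simp
  moreover have "\<forall>z\<in>level g -` {t}. (t + poly g (snd z), snd z) = z"
    unfolding level_fiber_eq by auto
  ultimately show ?thesis
    unfolding iso_to_line_def
    by (intro bexI[of _ "\<lambda>y. t + poly g y"] bexI[of _ "\<lambda>y. y"] bexI[of _ snd] conjI allI
        regular1_id regular2_snd) blast+
qed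

section \<open>The cyclic group generated by a bijection\<close>

lemma bij_in_Bij_UNIV: "bij f \<longleftrightarrow> f \<in> Bij UNIV"
  by (simp add: Bij_def)

lemma cyc_id: "id \<in> cyc \<phi>"
proof -
  have "\<one>\<^bsub>BijGroup UNIV\<^esub> = (id :: 'a \<times> 'a \<Rightarrow> 'a \<times> 'a)"
    by (auto simp: BijGroup_def)
  then show ?thesis
    unfolding cyc_def using generate.one by metis
qed

text \<open>
  A property that holds for the identity, \<open>\<phi>\<close> and its inverse and that composition preserves holds on the
  whole group. This reduces invariance under the group to invariance under \<open>\<phi>\<close>.
\<close>

lemma cyc_induct [consumes 2, case_names id gen inv comp]:
  assumes "bij \<phi>" "h \<in> cyc \<phi>"
    and "Q id" "Q \<phi>" "Q (inv_into UNIV \<phi>)"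
    and comp: "\<And>f h. Q f \<Longrightarrow> Q h \<Longrightarrow> Q (f \<circ> h)"
  shows "Q h"
proof -
  have \<phi>: "\<phi> \<in> Bij UNIV"
    using assms(1) by (simp add: bij_in_Bij_UNIV)
  have sub: "generate (BijGroup UNIV) {\<phi>} \<subseteq> Bij UNIV"
    using group.generate_incl[OF group_BijGroup, of "{\<phi>}" UNIV] \<phi> by (simp add: BijGroup_def)
  show ?thesis
    using assms(2) unfolding cyc_def
  proof (induction rule: generate.induct)
    case one
    then show ?case
      using assms(3) by (simp add: BijGroup_def id_def)
  next
    case (incl h)
    then show ?case
      using assms(4) by simp
  next
    case (inv h)
    then show ?case
      using assms(5) \<phi> by (simp add: inv_BijGroup)
  next
    case (eng h1 h2)
    then have "h1 \<otimes>\<^bsub>BijGroup UNIV\<^esub> h2 = h1 \<circ> h2"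
      using sub by (auto simp: BijGroup_def compose_def)
    then show ?case
      using comp[OF eng.IH] by (simp only:)
  qed
qed

lemma cyc_funpow:
  assumes "bij \<phi>"
  shows "\<phi> ^^ m \<in> cyc \<phi>"
proof (induction m)
  case 0
  then show ?case
    by (simp only: funpow.simps cyc_id)
next
  case (Suc m)
  have "\<phi> \<otimes>\<^bsub>BijGroup UNIV\<^esub> (\<phi> ^^ m) = \<phi> \<circ> \<phi> ^^ m"
    using assms by (auto simp: BijGroup_def bij_in_Bij_UNIV[symmetric] bij_fn compose_def)
  moreover have "\<phi> \<otimes>\<^bsub>BijGroup UNIV\<^esub> (\<phi> ^^ m) \<in> cyc \<phi>"
    using Suc unfolding cyc_def by (intro generate.eng generate.incl[OF singletonI])
  ultimately show ?case
    by (simp only: funpow.simps)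
qed

lemma lattice_of_iff:
  assumes "bij \<phi>"
  shows "Y \<in> lattice_of \<phi> \<longleftrightarrow> zclosed Y \<and> \<phi> ` Y = Y"
proof -
  have "h ` Y = Y" if "\<phi> ` Y = Y" "h \<in> cyc \<phi>" for h
    using assms that(2)
  proof (induction rule: cyc_induct)
    case inv
    then show ?case
      using that(1) assms by (metis bij_is_inj image_inv_f_f)
  next
    case (comp h1 h2)
    then show ?case
      by (simp only: image_comp[symmetric])
  qed (simp_all add: that(1))
  moreover have "\<phi> \<in> cyc \<phi>"
    using cyc_funpow[OF assms, of 1] by simp
  ultimately show ?thesis
    unfolding lattice_of_def inv_lattice_def by blast
qed

lemma cyc_invariant_iff:
  assumes "bij \<phi>"
  shows "(\<forall>h\<in>cyc \<phi>. f \<circ> h = f) \<longleftrightarrow> f \<circ> \<phi> = f"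
proof -
  have "f \<circ> h = f" if "f \<circ> \<phi> = f" "h \<in> cyc \<phi>" for h
    using assms that(2)
  proof (induction rule: cyc_induct)
    case inv
    then show ?case
      using that(1) assms by (metis bij_is_surj comp_assoc comp_id surj_iff)
  next
    case (comp h1 h2)
    then show ?case
      by (metis comp_assoc)
  qed (auto simp: that(1))
  moreover have "\<phi> \<in> cyc \<phi>"
    using cyc_funpow[OF assms, of 1] by simp
  ultimately show ?thesis
    by blast
qed

section \<open>Difference equations for polynomials\<close>

text \<open>
  The two leading coefficients of the shifted monomial decide the solvability of the difference
  equations: the first one cancels in \<open>g (y + c) - g (y)\<close>, and then the second one leads.
\<close>

lemma monom_shift:
  fixes c :: "'k::field_char_0"
  shows "degree (pcompose (monom l m) [:c, 1:]) \<le> m"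
    and "coeff (pcompose (monom l m) [:c, 1:]) m = l"
    and "m > 0 \<Longrightarrow> coeff (pcompose (monom l m) [:c, 1:]) (m - 1) = l * of_nat m * c"
proof -
  have "pcompose ([:0, 1:] ^ m) [:c, 1:] = [:c, 1:] ^ m"
    by (induction m) (simp_all add: pcompose_1 pcompose_mult pcompose_pCons)
  then have eq: "pcompose (monom l m) [:c, 1:] = smult l ([:c, 1:] ^ m)"
    by (simp add: monom_altdef pcompose_smult)
  show "degree (pcompose (monom l m) [:c, 1:]) \<le> m"
    unfolding eq using degree_power_le[of "[:c, 1:]" m] degree_smult_le order_trans by fastforce
  show "coeff (pcompose (monom l m) [:c, 1:]) m = l"
    unfolding eq by (simp add: coeff_linear_poly_power)
  show "coeff (pcompose (monom l m) [:c, 1:]) (m - 1) = l * of_nat m * c" if "m > 0"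
    unfolding eq coeff_smult using that
    by (cases m) (simp_all add: coeff_linear_poly_power del: power_Suc of_nat_Suc)
qed

text \<open>
  A monomial with leading coefficient \<open>lead_coeff P / (1 - a)\<close> solves the equation up to terms of lower
  degree, and these are handled by induction on the degree.
\<close>

lemma ex_twisted_difference:
  fixes a c :: "'k::field_char_0"
  assumes "a \<noteq> 1"
  shows "\<exists>g. pcompose g [:c, 1:] - smult a g = P"
proof (induction "degree P" arbitrary: P rule: less_induct)
  case less
  define n where "n = degree P"
  define g0 where "g0 = monom (lead_coeff P / (1 - a)) n"
  define R where "R = P - (pcompose g0 [:c, 1:] - smult a g0)"
  have "degree R \<le> n"
    unfolding R_def g0_def n_def
    by (intro degree_diff_le monom_shift order_trans[OF degree_smult_le] degree_monom_le)
      auto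
  moreover have "coeff R n = 0"
    using assms by (simp add: R_def g0_def monom_shift n_def field_simps)
  ultimately have "R = 0 \<or> degree R < degree P"
    unfolding n_def by (metis eq_zero_or_degree_less)
  then obtain g1 where "pcompose g1 [:c, 1:] - smult a g1 = R"
  proof
    assume "R = 0"
    then show ?thesis
      using that[of 0] by simp
  qed (use less that in blast)
  then have "pcompose (g0 + g1) [:c, 1:] - smult a (g0 + g1) = P"
    by (simp add: pcompose_add smult_add_right R_def algebra_simps)
  then show ?case
    by blast
qed

text \<open>
  With \<open>n = deg P\<close>, the solution must start in degree \<open>n + 1\<close>, because the top coefficient of \<open>l y^(n + 1)\<close> cancels
  and leaves \<open>l (n + 1) c y^n\<close>. The corrections have degree at most \<open>n\<close>, so they do not change
  the degree of the solution.
\<close>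

lemma ex_difference:
  fixes c :: "'k::field_char_0"
  assumes "c \<noteq> 0" "P \<noteq> 0"
  shows "\<exists>g. pcompose g [:c, 1:] - g = P \<and> degree g = Suc (degree P)"
  using assms(2)
proof (induction "degree P" arbitrary: P rule: less_induct)
  case less
  define n where "n = degree P"
  define l where "l = lead_coeff P / (of_nat (Suc n) * c)"
  have l: "l \<noteq> 0" "l * (of_nat (Suc n) * c) = lead_coeff P"
    using less(2) assms(1) unfolding l_def by (simp_all del: of_nat_Suc)
  define g0 where "g0 = monom l (Suc n)"
  define R where "R = P - (pcompose g0 [:c, 1:] - g0)"
  have deg0: "degree g0 = Suc n"
    using l by (simp add: g0_def degree_monom_eq)
  have "degree (pcompose g0 [:c, 1:] - g0) \<le> n"
  proof -
    have "degree (pcompose g0 [:c, 1:] - g0) \<le> Suc n"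
      unfolding g0_def by (intro degree_diff_le monom_shift degree_monom_le)
    moreover have "coeff (pcompose g0 [:c, 1:] - g0) (Suc n) = 0"
      by (simp add: g0_def monom_shift)
    ultimately show ?thesis
      by (metis eq_zero_or_degree_less degree_0 less_Suc_eq_le zero_le)
  qed
  then have "degree R \<le> n"
    unfolding R_def n_def by (rule degree_diff_le[OF order_refl])
  moreover have "coeff R n = 0"
    using monom_shift(3)[of "Suc n" l c] l
    by (simp add: R_def g0_def n_def mult.assoc)
  ultimately have "R = 0 \<or> R \<noteq> 0 \<and> degree R < degree P"
    unfolding n_def by (metis eq_zero_or_degree_less)
  then obtain g1 where g1: "pcompose g1 [:c, 1:] - g1 = R" "degree g1 < Suc n"
  proof
    assume "R = 0"
    then show ?thesis
      using that[of 0] by simp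
  next
    assume "R \<noteq> 0 \<and> degree R < degree P"
    then show ?thesis
      using less(1)[of R] that unfolding n_def by (metis Suc_mono)
  qed
  have "pcompose (g0 + g1) [:c, 1:] - (g0 + g1) = P"
    using g1(1) by (simp add: pcompose_add R_def algebra_simps)
  moreover have "degree (g0 + g1) = Suc (degree P)"
    using g1(2) deg0 by (simp add: degree_add_eq_left n_def)
  ultimately show ?case
    by blast
qed

section \<open>Independence of exponential polynomials\<close>

text \<open>
  If \<open>s (m) = \<mu>^m p (m)\<close>, then \<open>s (m + 1) - \<nu> s (m) = \<mu>^m q (m)\<close> with the polynomial \<open>q\<close> below. Its coefficient
  in degree \<open>deg p\<close> is \<open>\<mu> - \<nu>\<close> times that of \<open>p\<close>.
\<close>

lemma twisted_shift:
  fixes p :: "'k::field_char_0 poly" and \<mu> \<nu> :: 'k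
  defines "q \<equiv> smult \<mu> (pcompose p [:1, 1:]) - smult \<nu> p"
  assumes "p \<noteq> 0"
  shows twisted_shift_distinct: "\<mu> \<noteq> \<nu> \<Longrightarrow> q \<noteq> 0 \<and> degree q = degree p"
    and twisted_shift_same: "\<mu> = \<nu> \<Longrightarrow> q = 0 \<or> degree q < degree p"
proof -
  have "degree (pcompose p [:1, 1:]) = degree p"
    by (simp add: degree_pcompose)
  moreover have "lead_coeff (pcompose p [:1, 1:]) = lead_coeff p"
    by (subst lead_coeff_comp) simp_all
  ultimately have deg: "degree q \<le> degree p" and coeff: "coeff q (degree p) = (\<mu> - \<nu>) * lead_coeff p"
    unfolding q_def
    by (auto intro!: degree_diff_le order_trans[OF degree_smult_le] simp: algebra_simps)
  show "q \<noteq> 0 \<and> degree q = degree p" if "\<mu> \<noteq> \<nu>"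
  proof -
    have "coeff q (degree p) \<noteq> 0"
      using coeff that assms(2) by simp
    then show ?thesis
      using deg le_degree[of q "degree p"] by force
  qed
  show "q = 0 \<or> degree q < degree p" if "\<mu> = \<nu>"
    using deg coeff that by (simp add: eq_zero_or_degree_less)
qed

text \<open>
  Apply the operator \<open>s (m) \<mapsto> s (m + 1) - \<mu>\<^sub>k s (m)\<close> to the relation, where \<open>p\<^sub>k \<noteq> 0\<close>. It gives a relation of
  the same kind in which the \<open>k\<close>-th polynomial has become smaller while the other ones have kept
  their degree. By induction on the total size all polynomials of the new relation vanish. Hence
  \<open>p\<^sub>i = 0\<close> for all \<open>i \<noteq> k\<close>, and what remains of the relation says that \<open>p\<^sub>k\<close> vanishes at all natural
  numbers.
\<close>

lemma exponential_polynomials_independent: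
  fixes p :: "'i \<Rightarrow> 'k::field_char_0 poly" and \<mu> :: "'i \<Rightarrow> 'k"
  assumes "finite I" "inj_on \<mu> I" "\<And>i. i \<in> I \<Longrightarrow> \<mu> i \<noteq> 0"
    and "\<And>m::nat. (\<Sum>i\<in>I. \<mu> i ^ m * poly (p i) (of_nat m)) = 0"
    and "j \<in> I"
  shows "p j = 0"
proof -
  \<comment> \<open>The zero polynomial gets a smaller weight than the nonzero constants, which the operator may annihilate.\<close>
  define w where "w = (\<lambda>q :: 'k poly. if q = 0 then 0 else Suc (degree q))"
  have "\<forall>i\<in>I. p i = 0"
    using assms(4)
  proof (induction "\<Sum>i\<in>I. w (p i)" arbitrary: p rule: less_induct)
    case (less p)
    show ?case
    proof (rule ccontr)
      assume "\<not> (\<forall>i\<in>I. p i = 0)"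
      then obtain k where k: "k \<in> I" "p k \<noteq> 0"
        by blast
      define q where "q = (\<lambda>i. smult (\<mu> i) (pcompose (p i) [:1, 1:]) - smult (\<mu> k) (p i))"
      have w_le: "w (q i) = w (p i)" if "i \<in> I" "i \<noteq> k" for i
      proof (cases "p i = 0")
        case True
        then show ?thesis
          by (simp add: q_def)
      next
        case False
        have "\<mu> i \<noteq> \<mu> k"
          using assms(2) that k(1) by (meson inj_onD)
        then show ?thesis
          using twisted_shift_distinct[OF False] False by (simp add: q_def w_def)
      qed
      have w_less: "w (q k) < w (p k)"
        using twisted_shift_same[OF k(2), of "\<mu> k" "\<mu> k"] k(2) by (auto simp: q_def w_def)
      have "(\<Sum>i\<in>I. w (q i)) < (\<Sum>i\<in>I. w (p i))"
        using assms(1) k(1) w_le w_less by (intro sum_strict_mono_ex1) force+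
      moreover have "(\<Sum>i\<in>I. \<mu> i ^ m * poly (q i) (of_nat m)) = 0" for m
      proof -
        have "(\<Sum>i\<in>I. \<mu> i ^ m * poly (q i) (of_nat m)) =
          (\<Sum>i\<in>I. \<mu> i ^ Suc m * poly (p i) (of_nat (Suc m)))
          - \<mu> k * (\<Sum>i\<in>I. \<mu> i ^ m * poly (p i) (of_nat m))"
          by (simp add: q_def poly_pcompose sum_distrib_left sum_subtractf[symmetric] algebra_simps)
        then show ?thesis
          by (simp only: less(2) mult_zero_right diff_zero)
      qed
      ultimately have "\<forall>i\<in>I. q i = 0"
        using less(1) by blast
      then have others: "p i = 0" if "i \<in> I - {k}" for i
        using w_le[of i] that by (auto simp: w_def split: if_splits)
      have "poly (p k) (of_nat m) = 0" for m
      proof -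
        have "(\<Sum>i\<in>I. \<mu> i ^ m * poly (p i) (of_nat m)) = \<mu> k ^ m * poly (p k) (of_nat m)"
          using assms(1) k(1) others by (subst sum.remove[of I k]) simp_all
        then show ?thesis
          using less(2) assms(3)[OF k(1)] by simp
      qed
      then have "range of_nat \<subseteq> {t. poly (p k) t = 0}"
        by blast
      then have "finite (range (of_nat :: nat \<Rightarrow> 'k))"
        using poly_roots_finite[OF k(2)] finite_subset by blast
      then show False
        using finite_imageD[OF _ inj_of_nat] by blast
    qed
  qed
  then show ?thesis
    using assms(5) by blast
qed

text \<open>
  Density of the orbit of \<open>(u, v)\<close> under \<open>(u, v) \<mapsto> (a u, v + c)\<close>. Ordered by powers of the first
  coordinate, the values of \<open>f\<close> on the orbit form an exponential polynomial with bases \<open>a^i\<close>, which are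
  distinct because \<open>a\<close> is not a root of unity.
\<close>

lemma regular2_zero_if_zero_on_orbit:
  fixes a c u v :: "'k::field_char_0"
  assumes f: "f \<in> regular2" and a: "a \<noteq> 0" "\<not> root_of_unity a" and "u \<noteq> 0" "c \<noteq> 0"
    and zero: "\<And>m::nat. f (a ^ m * u, v + of_nat m * c) = 0"
  shows "f z = 0"
proof -
  \<comment> \<open>The outer variable of the representing polynomials is the second coordinate; swapping makes it the first.\<close>
  have "(\<lambda>w. f (snd w, fst w)) \<in> regular2"
    using f by (intro regular2_comp_pair regular2_fst regular2_snd)
  then obtain h where "(\<lambda>w. f (snd w, fst w)) = eval2 h"
    by (auto simp: regular2_def)
  then have h: "f (s, t) = eval2 h (t, s)" for s t
    by (metis fst_conv snd_conv)
  have expand: "f (s, t) = (\<Sum>i\<le>degree h. s ^ i * poly (coeff h i) t)" for s t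
    unfolding h by (simp add: eval2_def poly_altdef[of h] poly_sum mult.commute poly_power)
  have inj: "inj_on (\<lambda>i. a ^ i) {..degree h}"
  proof (rule linorder_inj_onI)
    fix i j :: nat
    assume "i < j"
    have "a ^ i * a ^ (j - i) = a ^ j"
      using \<open>i < j\<close> by (simp flip: power_add)
    moreover have "a ^ (j - i) \<noteq> 1"
      using a(2) \<open>i < j\<close> unfolding root_of_unity_def by (metis zero_less_diff)
    ultimately show "a ^ i \<noteq> a ^ j"
      using a(1) by (metis mult_cancel_left2 power_eq_0_iff)
  qed auto
  define p where "p = (\<lambda>i. smult (u ^ i) (pcompose (coeff h i) [:v, c:]))"
  have "p i = 0" if "i \<le> degree h" for i
  proof (rule exponential_polynomials_independent[OF _ inj])
    show "(\<Sum>i\<le>degree h. (a ^ i) ^ m * poly (p i) (of_nat m)) = 0" for m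
      using zero[of m] unfolding expand p_def
      by (simp add: poly_pcompose power_mult_distrib mult_ac flip: power_mult)
  qed (use a that in auto)
  then have "coeff h i = 0" if "i \<le> degree h" for i
    using that assms(4,5) by (simp add: p_def pcompose_eq_0_iff)
  then have "f (s, t) = 0" for s t
    unfolding expand by simp
  then show ?thesis
    by (cases z) simp
qed

section \<open>Maps that scale a sheared coordinate and translate along its fibers\<close>

text \<open>
  The map \<open>(u, y) \<mapsto> (a u, y + c)\<close>, written in the coordinates \<open>x = u + g (y)\<close> and \<open>y\<close>.
\<close>

locale scaling_translation =
  fixes a c :: "'k::field_char_0" and g :: "'k poly" and \<phi> :: "'k \<times> 'k \<Rightarrow> 'k \<times> 'k"
  assumes a_nonzero: "a \<noteq> 0" and c_nonzero: "c \<noteq> 0"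
    and \<phi>_eq: "\<phi> (x, y) = (a * (x - poly g y) + poly g (y + c), y + c)"
begin

lemma funpow_eq:
  "(\<phi> ^^ m) (x, y) = (a ^ m * (x - poly g y) + poly g (y + of_nat m * c), y + of_nat m * c)"
  by (induction m) (simp_all add: \<phi>_eq algebra_simps)

lemma level_funpow: "level g ((\<phi> ^^ m) z) = a ^ m * level g z"
  by (cases z) (simp add: funpow_eq)

lemma level_\<phi>: "level g (\<phi> z) = a * level g z"
  by (cases z) (simp add: \<phi>_eq)

lemma bij: "bij \<phi>"
proof (rule o_bij)
  define \<psi> where "\<psi> = (\<lambda>(x, y). ((x - poly g y) / a + poly g (y - c), y - c))"
  show "\<psi> \<circ> \<phi> = id" "\<phi> \<circ> \<psi> = id"
    using a_nonzero by (auto simp: \<psi>_def \<phi>_eq fun_eq_iff)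
qed

lemma in_lattice_iff: "Y \<in> lattice_of \<phi> \<longleftrightarrow> zclosed Y \<and> \<phi> ` Y = Y"
  by (rule lattice_of_iff[OF bij])

lemma funpow_in_invariant:
  assumes "Y \<in> lattice_of \<phi>" "z \<in> Y"
  shows "(\<phi> ^^ m) z \<in> Y"
  using assms by (induction m) (auto simp: in_lattice_iff)

lemma vimage_imp_image:
  assumes "\<And>z. \<phi> z \<in> Y \<longleftrightarrow> z \<in> Y"
  shows "\<phi> ` Y = Y"
proof -
  have "\<phi> -` Y = Y"
    using assms unfolding vimage_def by simp
  then show ?thesis
    using surj_image_vimage_eq[OF bij_is_surj[OF bij], of Y] by simp
qed

lemma no_torsion_point: "\<not> torsion_point \<phi> z"
proof
  assume "torsion_point \<phi> z"
  then have "finite ((\<lambda>h. h z) ` cyc \<phi>)"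
    by (simp add: torsion_point_def)
  moreover have "range (\<lambda>m. (\<phi> ^^ m) z) \<subseteq> (\<lambda>h. h z) ` cyc \<phi>"
    using cyc_funpow[OF bij] by blast
  ultimately have "finite (range (\<lambda>m. (\<phi> ^^ m) z))"
    using finite_subset by blast
  moreover have "inj (\<lambda>m. (\<phi> ^^ m) z)"
    using c_nonzero by (cases z) (auto intro!: injI simp: funpow_eq)
  ultimately show False
    using finite_imageD by blast
qed

text \<open>
  The condition on \<open>k\<close> says that the \<open>k\<close>-th iterate preserves the fiber of \<open>z\<close>. It covers both uses: \<open>a^k = 1\<close>
  with an arbitrary fiber, and the zero fiber with an arbitrary \<open>a\<close>. The points \<open>\<phi>^(k m) (z)\<close> lie on the
  fiber and have distinct second coordinates.
\<close>

lemma fiber_subset_invariant: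
  assumes Y: "Y \<in> lattice_of \<phi>" and z: "z \<in> Y"
    and k: "k > 0" "a ^ k * level g z = level g z"
  shows "level g -` {level g z} \<subseteq> Y"
proof (rule level_fiber_subset_closed)
  show "zclosed Y"
    using Y by (simp add: in_lattice_iff)
  have pow: "a ^ (k * m) * level g z = level g z" for m
    using k(2) by (induction m) (auto simp: power_add)
  have "(\<phi> ^^ (k * m)) z \<in> Y \<inter> level g -` {level g z}" for m
    using funpow_in_invariant[OF Y z] by (simp only: Int_iff vimage_singleton_eq level_funpow pow)
  then have "range (\<lambda>m. (\<phi> ^^ (k * m)) z) \<subseteq> Y \<inter> level g -` {level g z}"
    by blast
  moreover have "inj (\<lambda>m. (\<phi> ^^ (k * m)) z)"
    using c_nonzero k(1) by (cases z) (auto intro!: injI simp: funpow_eq)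
  ultimately show "infinite (Y \<inter> level g -` {level g z})"
    using finite_imageD finite_subset by blast
qed

lemma invariant_union_of_fibers:
  assumes Y: "Y \<in> lattice_of \<phi>" and k: "k > 0" "a ^ k = 1"
  shows "\<exists>S\<subseteq>fibers (level g). Y = \<Union> S"
proof (intro exI conjI)
  show "(\<lambda>z. level g -` {level g z}) ` Y \<subseteq> fibers (level g)"
    by (auto simp: fibers_def)
  have "level g -` {level g z} \<subseteq> Y" if "z \<in> Y" for z
    using fiber_subset_invariant[OF Y that k(1)] k(2) by simp
  then show "Y = \<Union> ((\<lambda>z. level g -` {level g z}) ` Y)"
    by blast
qed

text \<open>
  The function \<open>u^k\<close>, where \<open>u\<close> is the level, is invariant; its fiber through \<open>z\<close> is closed, invariant and
  proper.
\<close>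

lemma Supp_UNIV:
  assumes k: "k > 0" "a ^ k = 1"
  shows "Supp (lattice_of \<phi>) = UNIV"
proof -
  have "\<exists>Y\<in>lattice_of \<phi>. Y \<noteq> UNIV \<and> z \<in> Y" for z
  proof (intro bexI conjI)
    define Y where "Y = {w. level g w ^ k - level g z ^ k = 0}"
    have "zclosed Y"
      unfolding Y_def
      by (intro zclosed_zeros regular2_diff regular2_power regular2_level regular2_const)
    moreover have "\<phi> ` Y = Y"
      using k(2) by (intro vimage_imp_image) (simp add: Y_def level_\<phi> power_mult_distrib)
    ultimately show "Y \<in> lattice_of \<phi>"
      by (simp add: in_lattice_iff)
    show "z \<in> Y"
      by (simp add: Y_def)
    show "Y \<noteq> UNIV"
    proof
      assume "Y = UNIV"
      then have "(poly g 0, 0) \<in> Y" "(1 + poly g 0, 0) \<in> Y"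
        by auto
      then show False
        using k(1) by (simp add: Y_def power_0_left)
    qed
  qed
  then show ?thesis
    unfolding Supp_def by blast
qed

lemma equivariant_level: "equivariant \<phi> (level g)"
proof -
  have inverse: "(\<lambda>t. t / a) \<circ> (\<lambda>t. a * t) = id" "(\<lambda>t. a * t) \<circ> (\<lambda>t. t / a) = id"
    using a_nonzero by auto
  have "inv_into UNIV (\<lambda>t. a * t) = (\<lambda>t. t / a)"
    by (rule inv_unique_comp[OF inverse(2,1)])
  moreover have "(\<lambda>t. a * t) \<in> regular1" "(\<lambda>t. t / a) \<in> regular1"
    using regular1_mult[OF regular1_const regular1_id, of a]
      regular1_mult[OF regular1_const regular1_id, of "inverse a"]
    by (simp_all add: field_simps)
  ultimately have "(\<lambda>t. a * t) \<in> aut_line"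
    unfolding aut_line_def using o_bij[OF inverse] by simp
  moreover have "level g \<circ> \<phi> = (\<lambda>t. a * t) \<circ> level g"
    by (rule ext) (simp only: o_apply level_\<phi>)
  ultimately show ?thesis
    unfolding equivariant_def using regular2_level by blast
qed

lemma fiber_in_lattice:
  assumes "a * t = t"
  shows "level g -` {t} \<in> lattice_of \<phi>"
proof -
  have "a * s = t \<longleftrightarrow> s = t" for s
    using assms a_nonzero by (metis mult_left_cancel)
  then have "\<phi> ` (level g -` {t}) = level g -` {t}"
    by (intro vimage_imp_image) (simp only: vimage_singleton_eq level_\<phi>)
  then show ?thesis
    using zclosed_level_fiber by (simp add: in_lattice_iff)
qed

lemma generates_fibers:
  assumes "a = 1"
  shows "generates (fibers (level g)) (lattice_of \<phi>)"
  using fiber_in_lattice invariant_union_of_fibers[of _ 1] assms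
  unfolding generates_def fibers_def by auto

text \<open>
  A nonempty invariant closed set contains a fiber, and so the chain of a point in that fiber.
\<close>

lemma invariant_not_dim_0:
  assumes "a = 1" "Y \<in> lattice_of \<phi>"
  shows "\<not> has_dim Y 0"
proof
  assume dim: "has_dim Y 0"
  then obtain Z where "irr_chain Y 0 Z"
    by (auto simp: has_dim_def)
  then have "zirreducible (Z 0)" "Z 0 \<subseteq> Y"
    by (simp_all add: irr_chain_def)
  then obtain z where z: "z \<in> Y"
    unfolding zirreducible_def by blast
  then have "level g -` {level g z} \<subseteq> Y"
    using fiber_subset_invariant[OF assms(2) z, of 1] assms(1) by simp
  moreover have "z \<in> level g -` {level g z}"
    by simp
  ultimately have "irr_chain Y 1 (\<lambda>i. if i = 0 then {z} else level g -` {level g z})"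
    using irr_chain_level_fiber irr_chain_mono by blast
  then show False
    using dim unfolding has_dim_def by fastforce
qed

text \<open>
  An invariant \<open>f\<close> takes the same value at all points \<open>(t + g (m c), m c)\<close> of the fiber over \<open>t\<close>. It is thus
  constant on the fiber, and its value there is \<open>h (t) = f (t + g (0), 0)\<close>, a polynomial in \<open>t\<close>.
\<close>

lemma quotient_map_level:
  assumes "a = 1"
  shows "quotient_map (cyc \<phi>) (level g)"
proof -
  have invariant: "{f \<in> regular2. \<forall>h\<in>cyc \<phi>. f \<circ> h = f} = {f \<in> regular2. f \<circ> \<phi> = f}"
    by (simp add: cyc_invariant_iff[OF bij])
  have level: "level g (t + poly g y, y) = t" for t y
    by simp
  have "bij_betw (\<lambda>h. h \<circ> level g) regular1 {f \<in> regular2. f \<circ> \<phi> = f}"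
  proof (rule bij_betw_imageI)
    show "inj_on (\<lambda>h. h \<circ> level g) regular1"
    proof (rule inj_onI)
      fix h1 h2 :: "'k \<Rightarrow> 'k"
      assume "h1 \<circ> level g = h2 \<circ> level g"
      then show "h1 = h2"
        by (metis (no_types, lifting) ext level o_apply)
    qed
    show "(\<lambda>h. h \<circ> level g) ` regular1 = {f \<in> regular2. f \<circ> \<phi> = f}"
    proof (intro equalityI subsetI)
      fix f
      assume "f \<in> (\<lambda>h. h \<circ> level g) ` regular1"
      then obtain h where f: "f = poly h \<circ> level g"
        by (auto simp: regular1_def)
      have "f \<in> regular2"
        unfolding f o_def by (rule regular2_poly_comp[OF regular2_level])
      moreover have "f \<circ> \<phi> = f"
        unfolding f using level_\<phi> assms by (simp add: fun_eq_iff \<phi>_eq)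
      ultimately show "f \<in> {f \<in> regular2. f \<circ> \<phi> = f}"
        by simp
    next
      fix f
      assume "f \<in> {f \<in> regular2. f \<circ> \<phi> = f}"
      then have f: "f \<in> regular2" "\<And>z. f (\<phi> z) = f z"
        by (auto simp: fun_eq_iff)
      have iter: "f ((\<phi> ^^ m) z) = f z" for m z
        by (induction m) (simp_all add: f(2))
      define h where "h = (\<lambda>t. f (t + poly g 0, 0))"
      have "h \<in> regular1"
        unfolding h_def using f(1)
        by (intro regular1_comp_pair regular1_add regular1_id regular1_const)
      moreover have "f z = h (level g z)" for z
      proof -
        define t where "t = level g z"
        \<comment> \<open>The deviation of \<open>f\<close> along the fiber from its value at second coordinate \<open>0\<close>.\<close>
        define D where "D = (\<lambda>y. f (t + poly g y, y) + (- 1) * h t)"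
        have "D \<in> regular1"
          unfolding D_def using f(1)
          by (intro regular1_comp_pair regular1_add regular1_mult regular1_id regular1_const
              regular1_poly)
        moreover have "infinite {y. D y = 0}"
        proof -
          have "D (of_nat m * c) = 0" for m
            using iter[of m "(t + poly g 0, 0)"] assms by (simp add: D_def h_def funpow_eq)
          then have "range (\<lambda>m. of_nat m * c) \<subseteq> {y. D y = 0}"
            by blast
          moreover have "inj (\<lambda>m. of_nat m * c)"
            using c_nonzero by (auto intro: injI)
          ultimately show ?thesis
            using finite_imageD finite_subset by blast
        qed
        ultimately have "D (snd z) = 0"
          by (rule regular1_zero_if_infinite_zeros)
        then show ?thesis
          by (cases z) (simp add: D_def t_def)
      qed
      ultimately show "f \<in> (\<lambda>h. h \<circ> level g) ` regular1"
        by (intro image_eqI[of _ _ h]) (auto simp: fun_eq_iff)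
    qed
  qed
  then show ?thesis
    unfolding quotient_map_def invariant using regular2_level by blast
qed

lemma invariant_UNIV_if_off_zero_fiber:
  assumes Y: "Y \<in> lattice_of \<phi>" and z: "z \<in> Y" "level g z \<noteq> 0"
    and a: "\<not> root_of_unity a"
  shows "Y = UNIV"
proof -
  obtain S where S: "S \<subseteq> regular2" "Y = {z. \<forall>f\<in>S. f z = 0}"
    using Y unfolding in_lattice_iff zclosed_iff_regular2 by blast
  have "f w = 0" if f: "f \<in> S" for f w
  proof -
    \<comment> \<open>The equation \<open>f\<close> of \<open>Y\<close> in the coordinates \<open>(u, y)\<close>.\<close>
    define F where "F = (\<lambda>w. f (fst w + poly g (snd w), snd w))"
    have "F \<in> regular2"
      unfolding F_def using f S(1)
      by (intro regular2_comp_pair regular2_add regular2_fst regular2_snd regular2_poly_comp) blast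
    moreover have "F (a ^ m * level g z, snd z + of_nat m * c) = 0" for m
      using funpow_in_invariant[OF Y z(1), of m] f S(2)
      by (cases z) (simp add: F_def funpow_eq)
    ultimately have "F (level g w, snd w) = 0"
      using regular2_zero_if_zero_on_orbit[OF _ a_nonzero a z(2) c_nonzero] by blast
    then show ?thesis
      by (cases w) (simp add: F_def)
  qed
  then show ?thesis
    unfolding S(2) by blast
qed

lemma lattice_three_elements:
  assumes a: "\<not> root_of_unity a"
  shows "lattice_of \<phi> = {{}, level g -` {0}, UNIV}"
proof (intro equalityI subsetI)
  fix Y
  assume Y: "Y \<in> lattice_of \<phi>"
  show "Y \<in> {{}, level g -` {0}, UNIV}"
  proof (cases "Y \<subseteq> level g -` {0}")
    case True
    have "level g -` {0} \<subseteq> Y" if z: "z \<in> Y" for z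
    proof -
      have "level g z = 0"
        using True z by blast
      then show ?thesis
        using fiber_subset_invariant[OF Y z, of 1] by simp
    qed
    then show ?thesis
      using True by blast
  next
    case False
    then obtain z where "z \<in> Y" "level g z \<noteq> 0"
      by blast
    then show ?thesis
      using invariant_UNIV_if_off_zero_fiber[OF Y _ _ a] by blast
  qed
next
  fix Y
  assume "Y \<in> {{}, level g -` {0}, UNIV}"
  then show "Y \<in> lattice_of \<phi>"
    using fiber_in_lattice[of 0] zclosed_empty zclosed_UNIV bij_is_surj[OF bij]
    by (auto simp: in_lattice_iff)
qed

lemma card_lattice:
  assumes "\<not> root_of_unity a"
  shows "card (lattice_of \<phi>) = 3"
proof -
  have "level g -` {0} \<noteq> {}"
    using infinite_level_fiber[of g 0] by force
  then show ?thesis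
    unfolding lattice_three_elements[OF assms] using level_fiber_neq_UNIV[of g 0]
    by (auto)
qed

end

section \<open>The invariant lattice\<close>

text \<open>
  Membership only provides some parameters with nonzero scale; the map determines its scale, as the
  difference of its first components at \<open>(1, 0)\<close> and \<open>(0, 0)\<close>.
\<close>

lemma jonq_map_scale_nonzero:
  fixes a c :: "'k::field_char_0"
  assumes "jonq_map a P 1 c \<in> jonq n"
  shows "a \<noteq> 0"
proof -
  obtain a' P' b' c' where eq: "jonq_map a P 1 c = jonq_map a' P' b' c'" and a': "a' \<noteq> 0"
    using assms by (auto simp: jonq_def)
  have "a = a'"
    using fun_cong[OF eq, of "(0, 0)"] fun_cong[OF eq, of "(1, 0)"] by (simp add: jonq_map_def)
  then show ?thesis
    using a' by simp
qed

lemma jonq_map_scaling_translation: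
  fixes a c :: "'k::field_char_0"
  assumes "a \<noteq> 0" "c \<noteq> 0" "pcompose g [:c, 1:] - smult a g = P"
  shows "scaling_translation a c g (jonq_map a P 1 c)"
proof
  show "jonq_map a P 1 c (x, y) = (a * (x - poly g y) + poly g (y + c), y + c)" for x y
    unfolding assms(3)[symmetric] jonq_map_def by (simp add: poly_pcompose algebra_simps)
qed (use assms in auto)

theorem proposition5p9:
  fixes a b c :: "'k :: {alg_closed_field, field_char_0}"
    and P :: "'k poly" and n :: nat and \<phi> :: "'k \<times> 'k \<Rightarrow> 'k \<times> 'k"
  assumes "\<phi> = jonq_map a P b c"
    and "\<phi> \<in> jonq n"
    and "P \<noteq> 0" and "degree P = n"
    and "b = 1" and "c \<noteq> 0"
  shows
    "(a = 1 \<longrightarrow>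
        Supp (lattice_of \<phi>) = UNIV \<and>
        (\<exists>g. degree g = n + 1 \<and>
             quotient_map (cyc \<phi>) (\<lambda>(x, y). x - poly g y) \<and>
             generates (fibers (\<lambda>(x, y). x - poly g y)) (lattice_of \<phi>)) \<and>
        \<not> (\<exists>Y\<in>lattice_of \<phi>. has_dim Y 0) \<and>
        \<not> (\<exists>z. torsion_point \<phi> z)) \<and>
     (a \<noteq> 1 \<and> root_of_unity a \<longrightarrow>
        Supp (lattice_of \<phi>) = UNIV \<and>
        (\<exists>\<pi>. equivariant \<phi> \<pi> \<and>
             (\<exists>I. generates I (lattice_of \<phi>) \<and>
                  (\<forall>Y\<in>I. \<exists>S\<subseteq>fibers \<pi>. Y = \<Union> S))) \<and>
        \<not> (\<exists>z. torsion_point \<phi> z)) \<and>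
     (\<not> root_of_unity a \<longrightarrow>
        (\<exists>C. lattice_of \<phi> = {{}, C, UNIV} \<and> card (lattice_of \<phi>) = 3 \<and>
             is_curve C \<and> iso_to_line C))"
proof -
  have \<phi>: "\<phi> = jonq_map a P 1 c"
    using assms(1,5) by simp
  have a: "a \<noteq> 0"
    using jonq_map_scale_nonzero assms(2) unfolding \<phi> by blast
  show ?thesis
  proof (rule conjI[OF _ conjI]; rule impI)
    assume "a = 1"
    obtain g where g: "pcompose g [:c, 1:] - g = P" "degree g = n + 1"
      using ex_difference[OF assms(6,3)] assms(4) by auto
    interpret scaling_translation a c g \<phi>
      unfolding \<phi> using jonq_map_scaling_translation[OF a assms(6), of g P] g(1) \<open>a = 1\<close> by simp
    show "Supp (lattice_of \<phi>) = UNIV \<and>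
        (\<exists>g. degree g = n + 1 \<and>
             quotient_map (cyc \<phi>) (\<lambda>(x, y). x - poly g y) \<and>
             generates (fibers (\<lambda>(x, y). x - poly g y)) (lattice_of \<phi>)) \<and>
        \<not> (\<exists>Y\<in>lattice_of \<phi>. has_dim Y 0) \<and>
        \<not> (\<exists>z. torsion_point \<phi> z)"
      using Supp_UNIV[of 1] g(2) quotient_map_level generates_fibers invariant_not_dim_0
        no_torsion_point \<open>a = 1\<close> by auto
  next
    assume "a \<noteq> 1 \<and> root_of_unity a"
    then obtain k where "a \<noteq> 1" and k: "k > 0" "a ^ k = 1"
      by (auto simp: root_of_unity_def)
    obtain g where g: "pcompose g [:c, 1:] - smult a g = P"
      using ex_twisted_difference[OF \<open>a \<noteq> 1\<close>] by blast
    interpret scaling_translation a c g \<phi>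
      unfolding \<phi> using jonq_map_scaling_translation[OF a assms(6) g] .
    \<comment> \<open>All invariant closed sets are unions of fibers, so the lattice itself is a generating set as required.\<close>
    have "generates (lattice_of \<phi>) (lattice_of \<phi>)"
      unfolding generates_def by (metis cSup_singleton empty_subsetI insert_subset order_refl)
    then show "Supp (lattice_of \<phi>) = UNIV \<and>
        (\<exists>\<pi>. equivariant \<phi> \<pi> \<and>
             (\<exists>I. generates I (lattice_of \<phi>) \<and>
                  (\<forall>Y\<in>I. \<exists>S\<subseteq>fibers \<pi>. Y = \<Union> S))) \<and>
        \<not> (\<exists>z. torsion_point \<phi> z)"
      using Supp_UNIV[OF k] equivariant_level invariant_union_of_fibers[OF _ k] no_torsion_point
      by blast
  next
    assume nonroot: "\<not> root_of_unity a"
    then have "a \<noteq> 1"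
      by (auto simp: root_of_unity_def)
    obtain g where g: "pcompose g [:c, 1:] - smult a g = P"
      using ex_twisted_difference[OF \<open>a \<noteq> 1\<close>] by blast
    interpret scaling_translation a c g \<phi>
      unfolding \<phi> using jonq_map_scaling_translation[OF a assms(6) g] .
    show "\<exists>C. lattice_of \<phi> = {{}, C, UNIV} \<and> card (lattice_of \<phi>) = 3 \<and>
             is_curve C \<and> iso_to_line C"
      using lattice_three_elements[OF nonroot] card_lattice[OF nonroot]
        is_curve_level_fiber[of g 0] iso_to_line_level_fiber[of g 0] by blast
  qed
qed

end
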